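(* Let $G=(V,E)$ be a finite undirected graph. Then $G$ has a nowhere-zero four-flow if and only if $f_G\notin I_E$.
   Context: A four-flow on $G$ is a map $\phi:E\to\mathbb{Z}_2\times\mathbb{Z}_2$ with $\sum_{e\in\delta(v)}\phi(e)=(0,0)$ for every vertex $v$, where $\delta(v)$ is the set of edges incident to $v$; it is nowhere-zero if $\phi(e)\neq(0,0)$ for all $e$. With variables $x=(x_e)_{e\in E}$, $y=(y_e)_{e\in E}$, let $I_E:=\mathrm{ideal}\{x_e^2-1,\ y_e^2-1,\ (x_e+1)(y_e+1): e\in E\}\subseteq\mathbb{C}[x,y]$ and $f_G:=\prod_{v\in V}\Big(\prod_{e\in\delta(v)}x_e+1\Big)\Big(\prod_{e\in\delta(v)}y_e+1\Big)$. *)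

theory Defs
  imports Complex_Main "HOL-Library.Poly_Mapping" "HOL-Library.Z2" "HOL-Library.Product_Plus"
begin

text \<open>
  An undirected graph has a vertex set \<open>V\<close>, an edge set \<open>E\<close> and a map \<open>ends\<close> sending an edge to
  the set of its one or two end vertices. Parallel edges and loops are allowed; a simple graph is
  the case where edges are two-element sets of vertices and \<open>ends\<close> is the identity.
  Incident edges form a set, so a loop counts once at its vertex, both for flows and in \<open>f_poly\<close>.
\<close>

definition finite_graph :: "'v set \<Rightarrow> 'e set \<Rightarrow> ('e \<Rightarrow> 'v set) \<Rightarrow> bool" where
  "finite_graph V E ends \<longleftrightarrow>
     finite V \<and> finite E \<and> (\<forall>e\<in>E. ends e \<subseteq> V \<and> (card (ends e) = 1 \<or> card (ends e) = 2))"

definition incident_edges :: "'e set \<Rightarrow> ('e \<Rightarrow> 'v set) \<Rightarrow> 'v \<Rightarrow> 'e set" where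
  "incident_edges E ends v = {e \<in> E. v \<in> ends e}"

definition four_flow :: "'v set \<Rightarrow> 'e set \<Rightarrow> ('e \<Rightarrow> 'v set) \<Rightarrow> ('e \<Rightarrow> bit \<times> bit) \<Rightarrow> bool" where
  "four_flow V E ends \<phi> \<longleftrightarrow> (\<forall>v\<in>V. (\<Sum>e\<in>incident_edges E ends v. \<phi> e) = (0, 0))"

definition nowhere_zero :: "'e set \<Rightarrow> ('e \<Rightarrow> bit \<times> bit) \<Rightarrow> bool" where
  "nowhere_zero E \<phi> \<longleftrightarrow> (\<forall>e\<in>E. \<phi> e \<noteq> (0, 0))"

datatype 'e indet = X 'e | Y 'e

text \<open>
  A polynomial is a finitely supported map from monomials to coefficients, a monomial being a
  finitely supported map from indeterminates to exponents.
\<close>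

type_synonym 'e cpoly = "('e indet \<Rightarrow>\<^sub>0 nat) \<Rightarrow>\<^sub>0 complex"

definition var :: "'e indet \<Rightarrow> 'e cpoly" where
  "var i = Poly_Mapping.single (Poly_Mapping.single i 1) 1"

text \<open>
  The edge type may have elements outside \<open>E\<close>, so the ring $\mathbb{C}[x_e, y_e : e \in E]$ is a
  subring of the type of polynomials, and ideals are generated inside that subring.
\<close>

definition poly_ring :: "'e set \<Rightarrow> 'e cpoly set" where
  "poly_ring E = {p. \<forall>m\<in>Poly_Mapping.keys p. Poly_Mapping.keys m \<subseteq> X ` E \<union> Y ` E}"

definition generated_ideal :: "'a::comm_ring_1 set \<Rightarrow> 'a set \<Rightarrow> 'a set" where
  "generated_ideal R B = {(\<Sum>b\<in>T. r b * b) | T r. finite T \<and> T \<subseteq> B \<and> (\<forall>b\<in>T. r b \<in> R)}"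

definition I_poly :: "'e set \<Rightarrow> 'e cpoly set" where
  "I_poly E = generated_ideal (poly_ring E)
     (\<Union>e\<in>E. {var (X e) ^ 2 - 1, var (Y e) ^ 2 - 1, (var (X e) + 1) * (var (Y e) + 1)})"

definition f_poly :: "'v set \<Rightarrow> 'e set \<Rightarrow> ('e \<Rightarrow> 'v set) \<Rightarrow> 'e cpoly" where
  "f_poly V E ends =
     (\<Prod>v\<in>V. ((\<Prod>e\<in>incident_edges E ends v. var (X e)) + 1) *
            ((\<Prod>e\<in>incident_edges E ends v. var (Y e)) + 1))"

end

theory Submission
  imports Defs
begin

text \<open>
  Nowhere-zero maps \<open>\<phi>\<close> on \<open>E\<close> correspond to the common zeros of the generators of \<open>I_poly E\<close> via
  $x_e = (-1)^{\phi_1(e)}$, $y_e = (-1)^{\phi_2(e)}$, and \<open>f_poly\<close> is nonzero at such a point iff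
  \<open>\<phi>\<close> is a flow. Hence a flow prevents \<open>f_poly\<close> from lying in the ideal.
  Conversely, let $\delta_\phi = \prod_e (1 + (-1)^{\phi_1(e)} x_e)(1 + (-1)^{\phi_2(e)} y_e)$.
  Modulo the ideal, multiplying by $\delta_\phi$ evaluates a polynomial at the point of \<open>\<phi>\<close>, and
  the $\delta_\phi$ with \<open>\<phi>\<close> nowhere zero add up to the unit $4^{|E|}$; so if no \<open>\<phi>\<close> is a flow,
  then all $f_G \delta_\phi$, and therefore $f_G$, lie in the ideal.
\<close>

section \<open>Evaluation of polynomials\<close>

definition eval_monom :: "('i \<Rightarrow> 'a::comm_semiring_1) \<Rightarrow> ('i \<Rightarrow>\<^sub>0 nat) \<Rightarrow> 'a" where
  "eval_monom \<rho> m = (\<Prod>i\<in>Poly_Mapping.keys m. \<rho> i ^ Poly_Mapping.lookup m i)"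

definition eval_poly :: "('i \<Rightarrow> 'a::comm_semiring_1) \<Rightarrow> (('i \<Rightarrow>\<^sub>0 nat) \<Rightarrow>\<^sub>0 'a) \<Rightarrow> 'a" where
  "eval_poly \<rho> p = (\<Sum>m\<in>Poly_Mapping.keys p. Poly_Mapping.lookup p m * eval_monom \<rho> m)"

text \<open>Indeterminates outside the support have exponent 0 and contribute the factor 1, so
  monomials with different supports can be compared over one index set.\<close>

lemma eval_monom_superset:
  assumes "finite S" "Poly_Mapping.keys m \<subseteq> S"
  shows "eval_monom \<rho> m = (\<Prod>i\<in>S. \<rho> i ^ Poly_Mapping.lookup m i)"
  unfolding eval_monom_def using assms
  by (intro prod.mono_neutral_left) (auto simp: in_keys_iff)

lemma eval_monom_add: "eval_monom \<rho> (m + n) = eval_monom \<rho> m * eval_monom \<rho> n"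
proof -
  let ?S = "Poly_Mapping.keys m \<union> Poly_Mapping.keys n"
  have "Poly_Mapping.keys (m + n) \<subseteq> ?S" by (rule Poly_Mapping.keys_add)
  then show ?thesis
    by (simp add: eval_monom_superset[of ?S] lookup_add power_add prod.distrib)
qed

lemma eval_poly_single: "eval_poly \<rho> (Poly_Mapping.single m c) = c * eval_monom \<rho> m"
  by (simp add: eval_poly_def)

lemma eval_poly_0 [simp]: "eval_poly \<rho> 0 = 0"
  by (simp add: eval_poly_def)

lemma eval_poly_1 [simp]: "eval_poly \<rho> 1 = 1"
  using eval_poly_single[of \<rho> 0 1] by (simp add: eval_monom_def)

lemma eval_poly_add [simp]: "eval_poly \<rho> (p + q) = eval_poly \<rho> p + eval_poly \<rho> q"
  unfolding eval_poly_def by (rule setsum_keys_plus_distrib) (auto simp: algebra_simps)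

text \<open>An additive form of update induction, suited to properties preserved by adding a single
  term.\<close>

lemma poly_mapping_single_add_induct [case_names zero single_add]:
  fixes p :: "'a \<Rightarrow>\<^sub>0 'b::comm_monoid_add"
  assumes "P 0" "\<And>m c p. P p \<Longrightarrow> P (Poly_Mapping.single m c + p)"
  shows "P p"
proof (induction p rule: Poly_Mapping.update_induct)
  case const
  then show ?case by (rule assms)
next
  case (update p m c)
  \<comment> \<open>The key \<open>m\<close> is new, so its old coefficient is 0 and overwriting
    agrees with adding.\<close>
  have "Poly_Mapping.update m c p = Poly_Mapping.single m c + p"
    using update(1)
    by (intro poly_mapping_eqI) (auto simp: lookup_update lookup_add lookup_single in_keys_iff when_def)
  then show ?case using assms(2)[OF update(3)] by simp
qed

lemma eval_poly_mult [simp]: "eval_poly \<rho> (p * q) = eval_poly \<rho> p * eval_poly \<rho> q"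
proof (induction p rule: poly_mapping_single_add_induct)
  case zero
  then show ?case by simp
next
  case (single_add m c p)
  \<comment> \<open>Distributivity in both factors leaves only products of two single terms, where
    \<open>eval_monom_add\<close> applies.\<close>
  have "eval_poly \<rho> (Poly_Mapping.single m c * q) = eval_poly \<rho> (Poly_Mapping.single m c) * eval_poly \<rho> q"
    by (induction q rule: poly_mapping_single_add_induct)
      (simp_all add: distrib_left mult_single eval_poly_single eval_monom_add mult_ac)
  with single_add show ?case by (simp add: distrib_right)
qed

lemma eval_poly_diff [simp]:
  fixes p :: "('i \<Rightarrow>\<^sub>0 nat) \<Rightarrow>\<^sub>0 'a::comm_ring_1"
  shows "eval_poly \<rho> (p - q) = eval_poly \<rho> p - eval_poly \<rho> q"
  using eval_poly_add[of \<rho> "p - q" q] by (simp add: algebra_simps)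

lemma eval_poly_sum: "eval_poly \<rho> (sum g A) = (\<Sum>a\<in>A. eval_poly \<rho> (g a))"
  by (induction A rule: infinite_finite_induct) auto

lemma eval_poly_prod: "eval_poly \<rho> (prod g A) = (\<Prod>a\<in>A. eval_poly \<rho> (g a))"
  by (induction A rule: infinite_finite_induct) auto

lemma eval_poly_var [simp]: "eval_poly \<rho> (var i) = \<rho> i"
  by (simp add: var_def eval_poly_single eval_monom_def)

lemma eval_poly_generated_ideal:
  assumes "p \<in> generated_ideal R B" "\<And>b. b \<in> B \<Longrightarrow> eval_poly \<rho> b = 0"
  shows "eval_poly \<rho> p = 0"
  using assms unfolding generated_ideal_def by (auto simp: eval_poly_sum subset_iff intro!: sum.neutral)

section \<open>Subrings and generated ideals\<close>

definition subring_set :: "'a::comm_ring_1 set \<Rightarrow> bool" where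
  "subring_set R \<longleftrightarrow> 0 \<in> R \<and> 1 \<in> R \<and> (\<forall>a\<in>R. - a \<in> R) \<and>
     (\<forall>a\<in>R. \<forall>b\<in>R. a + b \<in> R) \<and> (\<forall>a\<in>R. \<forall>b\<in>R. a * b \<in> R)"

lemma subring_setD:
  assumes "subring_set R"
  shows "0 \<in> R" "1 \<in> R" "a \<in> R \<Longrightarrow> - a \<in> R" "a \<in> R \<Longrightarrow> b \<in> R \<Longrightarrow> a + b \<in> R"
    "a \<in> R \<Longrightarrow> b \<in> R \<Longrightarrow> a * b \<in> R"
  using assms by (auto simp: subring_set_def)

lemma subring_set_prod:
  assumes "subring_set R" "\<And>a. a \<in> A \<Longrightarrow> g a \<in> R"
  shows "prod g A \<in> R"
  using assms(2) by (induction A rule: infinite_finite_induct) (auto intro: subring_setD[OF assms(1)])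

lemma generated_ideal_0: "0 \<in> generated_ideal R B"
  unfolding generated_ideal_def by (auto intro!: exI[of _ "{}"])

lemma generated_ideal_base:
  assumes "subring_set R" "b \<in> B"
  shows "b \<in> generated_ideal R B"
  unfolding generated_ideal_def using assms subring_setD(2)[OF assms(1)]
  by (auto intro!: exI[of _ "{b}"] exI[of _ "\<lambda>_. 1"])

lemma generated_ideal_mult:
  assumes R: "subring_set R" and "a \<in> R" "p \<in> generated_ideal R B"
  shows "a * p \<in> generated_ideal R B"
proof -
  obtain T r where T: "finite T" "T \<subseteq> B" "\<forall>b\<in>T. r b \<in> R" "p = (\<Sum>b\<in>T. r b * b)"
    using assms(3) unfolding generated_ideal_def by blast
  have "a * p = (\<Sum>b\<in>T. (a * r b) * b)" by (simp add: T(4) sum_distrib_left mult.assoc)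
  moreover have "\<forall>b\<in>T. a * r b \<in> R" using T(3) assms(2) subring_setD(5)[OF R] by blast
  ultimately show ?thesis unfolding generated_ideal_def mem_Collect_eq
    by (intro exI[of _ T] exI[of _ "\<lambda>b. a * r b"]) (use T in auto)
qed

lemma generated_ideal_add:
  assumes R: "subring_set R" and "p \<in> generated_ideal R B" "q \<in> generated_ideal R B"
  shows "p + q \<in> generated_ideal R B"
proof -
  obtain T r where T: "finite T" "T \<subseteq> B" "\<forall>b\<in>T. r b \<in> R" "p = (\<Sum>b\<in>T. r b * b)"
    using assms(2) unfolding generated_ideal_def by blast
  obtain U s where U: "finite U" "U \<subseteq> B" "\<forall>b\<in>U. s b \<in> R" "q = (\<Sum>b\<in>U. s b * b)"
    using assms(3) unfolding generated_ideal_def by blast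
  \<comment> \<open>The two combinations may use different generators; coefficient 0 extends each to
    \<open>T \<union> U\<close>.\<close>
  define t where "t b = (if b \<in> T then r b else 0) + (if b \<in> U then s b else 0)" for b
  have "p = (\<Sum>b\<in>T \<union> U. (if b \<in> T then r b else 0) * b)"
    unfolding T(4) using T(1) U(1) by (intro sum.mono_neutral_cong_left) auto
  moreover have "q = (\<Sum>b\<in>T \<union> U. (if b \<in> U then s b else 0) * b)"
    unfolding U(4) using T(1) U(1) by (intro sum.mono_neutral_cong_left) auto
  ultimately have "p + q = (\<Sum>b\<in>T \<union> U. t b * b)"
    by (simp only: t_def sum.distrib distrib_right)
  moreover have "\<forall>b\<in>T \<union> U. t b \<in> R"
    using T(3) U(3) subring_setD[OF R] by (auto simp: t_def)
  ultimately show ?thesis unfolding generated_ideal_def mem_Collect_eq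
    by (intro exI[of _ "T \<union> U"] exI[of _ t]) (use T U in auto)
qed

section \<open>The ring \<open>poly_ring E\<close> and the ideal \<open>I_poly E\<close>\<close>

lemma single_0_in_poly_ring: "Poly_Mapping.single 0 c \<in> poly_ring E"
  by (simp add: poly_ring_def)

lemma subring_set_poly_ring: "subring_set (poly_ring E)"
proof -
  have add: "a + b \<in> poly_ring E" if "a \<in> poly_ring E" "b \<in> poly_ring E" for a b :: "'a cpoly"
    using that Poly_Mapping.keys_add[of a b] unfolding poly_ring_def by blast
  have mult: "a * b \<in> poly_ring E" if "a \<in> poly_ring E" "b \<in> poly_ring E" for a b :: "'a cpoly"
  proof -
    have "Poly_Mapping.keys m \<subseteq> X ` E \<union> Y ` E" if m: "m \<in> Poly_Mapping.keys (a * b)" for m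
    proof -
      obtain k l where "m = k + l" "k \<in> Poly_Mapping.keys a" "l \<in> Poly_Mapping.keys b"
        using m keys_mult[of a b] by blast
      with \<open>a \<in> poly_ring E\<close> \<open>b \<in> poly_ring E\<close> Poly_Mapping.keys_add[of k l] show ?thesis
        unfolding poly_ring_def by blast
    qed
    then show ?thesis by (simp add: poly_ring_def)
  qed
  have "- a \<in> poly_ring E" if "a \<in> poly_ring E" for a :: "'a cpoly"
    using that by (simp add: poly_ring_def)
  moreover have "0 \<in> poly_ring E" "1 \<in> poly_ring E"
    by (simp_all add: poly_ring_def)
  ultimately show ?thesis
    unfolding subring_set_def using add mult by blast
qed

lemma var_in_poly_ring: "i \<in> X ` E \<union> Y ` E \<Longrightarrow> var i \<in> poly_ring E"
  by (auto simp: var_def poly_ring_def)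

lemma I_poly_0: "0 \<in> I_poly E"
  unfolding I_poly_def by (rule generated_ideal_0)

lemma I_poly_add: "p \<in> I_poly E \<Longrightarrow> q \<in> I_poly E \<Longrightarrow> p + q \<in> I_poly E"
  unfolding I_poly_def by (rule generated_ideal_add[OF subring_set_poly_ring])

lemma I_poly_mult: "a \<in> poly_ring E \<Longrightarrow> p \<in> I_poly E \<Longrightarrow> a * p \<in> I_poly E"
  unfolding I_poly_def by (rule generated_ideal_mult[OF subring_set_poly_ring])

lemma I_poly_generators:
  assumes "e \<in> E"
  shows "var (X e) ^ 2 - 1 \<in> I_poly E" "var (Y e) ^ 2 - 1 \<in> I_poly E"
    "(var (X e) + 1) * (var (Y e) + 1) \<in> I_poly E"
  unfolding I_poly_def
  by (rule generated_ideal_base[OF subring_set_poly_ring], use assms in blast)+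

section \<open>Points of the variety\<close>

text \<open>The character sending b to (-1)^b. The target ring is left open: signs serve as complex
  coordinates in evaluation and as constant polynomials in interpolation.\<close>

definition sign_of_bit :: "bit \<Rightarrow> 'a::comm_ring_1" where
  "sign_of_bit b = (if b = 0 then 1 else - 1)"

lemma sign_of_bit_simps [simp]: "sign_of_bit 0 = 1" "sign_of_bit 1 = - 1"
  by (auto simp: sign_of_bit_def)

lemma sign_of_bit_square: "sign_of_bit b * sign_of_bit b = 1"
  by (simp add: sign_of_bit_def)

lemma sign_of_bit_add: "sign_of_bit (a + b) = sign_of_bit a * sign_of_bit b"
  by (cases a; cases b) auto

lemma sign_of_bit_sum: "sign_of_bit (sum g A) = (\<Prod>a\<in>A. sign_of_bit (g a))"
  by (induction A rule: infinite_finite_induct) (simp_all add: sign_of_bit_add del: add_bit_eq_xor)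

lemma sign_of_bit_in_subring: "subring_set R \<Longrightarrow> sign_of_bit b \<in> R"
  by (cases b) (simp_all add: subring_set_def)

fun flow_point :: "('e \<Rightarrow> bit \<times> bit) \<Rightarrow> 'e indet \<Rightarrow> 'a::comm_ring_1" where
  "flow_point \<phi> (X e) = sign_of_bit (fst (\<phi> e))"
| "flow_point \<phi> (Y e) = sign_of_bit (snd (\<phi> e))"

lemma four_flow_iff:
  "four_flow V E ends \<phi> \<longleftrightarrow> (\<forall>v\<in>V.
     (\<Sum>e\<in>incident_edges E ends v. fst (\<phi> e)) = 0 \<and> (\<Sum>e\<in>incident_edges E ends v. snd (\<phi> e)) = 0)"
  by (simp add: four_flow_def prod_eq_iff fst_sum snd_sum)

text \<open>Signs turn the zero sums at a vertex into products equal to 1, so every vertex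
  contributes (1 + 1)(1 + 1) = 4.\<close>

lemma eval_f_poly_flow_point_ne_0:
  assumes "finite V" "four_flow V E ends \<phi>"
  shows "eval_poly (flow_point \<phi>) (f_poly V E ends) \<noteq> 0"
  using assms
  by (auto simp: f_poly_def eval_poly_prod four_flow_iff simp flip: sign_of_bit_sum)

text \<open>Signs square to 1, and a nonzero value of \<phi> has a coordinate 1, whose sign -1 makes
  the third generator vanish.\<close>

lemma eval_I_poly_flow_point:
  assumes "nowhere_zero E \<phi>" "p \<in> I_poly E"
  shows "eval_poly (flow_point \<phi>) p = 0"
proof (rule eval_poly_generated_ideal[OF assms(2)[unfolded I_poly_def]])
  fix b assume "b \<in> (\<Union>e\<in>E. {var (X e) ^ 2 - 1, var (Y e) ^ 2 - 1, (var (X e) + 1) * (var (Y e) + 1)})"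
  then obtain e where e: "e \<in> E"
    "b \<in> {var (X e) ^ 2 - 1, var (Y e) ^ 2 - 1, (var (X e) + 1) * (var (Y e) + 1)}" by blast
  from e(1) assms(1) have "fst (\<phi> e) = 1 \<or> snd (\<phi> e) = 1"
    by (auto simp: nowhere_zero_def prod_eq_iff)
  with e(2) show "eval_poly (flow_point \<phi>) b = 0"
    by (auto simp: power2_eq_square sign_of_bit_square)
qed

section \<open>Interpolation modulo the ideal\<close>

text \<open>An unnormalised Lagrange polynomial: on the sign pairs it takes the value 4 at the pair
  of \<open>c\<close> and 0 at the other three.\<close>

definition edge_delta :: "'e \<Rightarrow> bit \<times> bit \<Rightarrow> 'e cpoly" where
  "edge_delta e c = (1 + sign_of_bit (fst c) * var (X e)) * (1 + sign_of_bit (snd c) * var (Y e))"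

definition point_delta :: "'e set \<Rightarrow> ('e \<Rightarrow> bit \<times> bit) \<Rightarrow> 'e cpoly" where
  "point_delta F \<phi> = (\<Prod>e\<in>F. edge_delta e (\<phi> e))"

lemma edge_delta_in_poly_ring: "e \<in> E \<Longrightarrow> edge_delta e c \<in> poly_ring E"
  unfolding edge_delta_def
  by (intro subring_setD[OF subring_set_poly_ring] sign_of_bit_in_subring subring_set_poly_ring
      var_in_poly_ring) auto

text \<open>The deltas of all four values add up to 4, and the one for \<open>(0, 0)\<close> is
  exactly the third generator. Modulo the ideal the three nonzero values therefore suffice.\<close>

lemma sum_edge_delta:
  "edge_delta e (0, 1) + edge_delta e (1, 0) + edge_delta e (1, 1)
     + (var (X e) + 1) * (var (Y e) + 1) = Poly_Mapping.single 0 4"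
proof -
  have "(1 + x) * (1 + - y) + (1 + - x) * (1 + y) + (1 + - x) * (1 + - y) + (x + 1) * (y + 1) = 4"
    for x y :: "'a cpoly"
    by (simp add: algebra_simps)
  from this[of "var (X e)" "var (Y e)"] show ?thesis
    by (simp only: edge_delta_def fst_conv snd_conv sign_of_bit_simps mult_1_left mult_minus1 single_numeral)
qed

text \<open>Induction removes one edge at a time, with \<open>g\<close> arbitrary so that the
  hypothesis applies to \<open>g * edge_delta e c\<close>. For empty \<open>F\<close> the delta is
  1.\<close>

lemma in_I_poly_if_point_delta:
  assumes "finite F" "F \<subseteq> E" "g \<in> poly_ring E"
    and "\<And>\<phi>. nowhere_zero F \<phi> \<Longrightarrow> g * point_delta F \<phi> \<in> I_poly E"
  shows "g \<in> I_poly E"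
  using assms
proof (induction F arbitrary: g rule: finite_induct)
  case empty
  then show ?case by (simp add: nowhere_zero_def point_delta_def)
next
  case (insert e F)
  have e: "e \<in> E" and F: "F \<subseteq> E" using insert.prems(1) by auto
  have delta: "g * edge_delta e c \<in> I_poly E" if "c \<noteq> (0, 0)" for c
  proof (rule insert.IH[OF F])
    show "g * edge_delta e c \<in> poly_ring E"
      using insert.prems(2) edge_delta_in_poly_ring[OF e] subring_setD(5)[OF subring_set_poly_ring] by blast
    fix \<phi> :: "'a \<Rightarrow> bit \<times> bit" assume "nowhere_zero F \<phi>"
    \<comment> \<open>Giving \<open>e\<close> the nonzero value \<open>c\<close> extends \<phi> to
      \<open>insert e F\<close> and changes nothing on \<open>F\<close>, since \<open>e\<close> is
      not in \<open>F\<close>.\<close>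
    then have "nowhere_zero (insert e F) (\<phi>(e := c))" using that by (auto simp: nowhere_zero_def)
    then have "g * point_delta (insert e F) (\<phi>(e := c)) \<in> I_poly E" by (rule insert.prems(3))
    moreover have "point_delta F (\<phi>(e := c)) = point_delta F \<phi>"
      unfolding point_delta_def using insert.hyps(2) by (intro prod.cong) auto
    ultimately show "g * edge_delta e c * point_delta F \<phi> \<in> I_poly E"
      using insert.hyps by (simp add: point_delta_def mult.assoc)
  qed
  have "g * edge_delta e (0, 1) + g * edge_delta e (1, 0) + g * edge_delta e (1, 1)
      + g * ((var (X e) + 1) * (var (Y e) + 1)) \<in> I_poly E"
    by (intro I_poly_add delta I_poly_mult insert.prems(2) I_poly_generators e) auto
  then have "g * Poly_Mapping.single 0 4 \<in> I_poly E"
    unfolding sum_edge_delta[of e, symmetric] by (simp only: distrib_left[of g])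
  \<comment> \<open>The constant 4 is cancelled by its inverse, which is available as the
    coefficients are complex.\<close>
  then have "Poly_Mapping.single 0 (1 / 4) * (g * Poly_Mapping.single 0 4) \<in> I_poly E"
    by (rule I_poly_mult[OF single_0_in_poly_ring])
  also have "Poly_Mapping.single 0 (1 / 4) * (g * Poly_Mapping.single 0 4) =
      g * (Poly_Mapping.single 0 (1 / 4) * Poly_Mapping.single 0 4)"
    by (simp only: mult_ac)
  also have "\<dots> = g"
    by (subst mult_single) simp
  finally show ?case .
qed

text \<open>The delta contains a factor 1 + s x for the variable x and its value s. Since s^2 = 1,
  (x - s)(1 + s x) = s (x^2 - 1), a multiple of a generator.\<close>

lemma var_times_point_delta:
  assumes "finite E" "i \<in> X ` E \<union> Y ` E"
  shows "(var i - flow_point \<phi> i) * point_delta E \<phi> \<in> I_poly E"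
proof -
  have root: "(x - s) * (1 + s * x) = s * (x ^ 2 - 1)" if "s * s = 1" for x s :: "'a cpoly"
  proof -
    have "(x - s) * (1 + s * x) = x + s * x ^ 2 - s - (s * s) * x"
      by (simp add: algebra_simps power2_eq_square)
    with that show ?thesis by (simp add: algebra_simps)
  qed
  obtain e where e: "e \<in> E" "i = X e \<or> i = Y e" using assms(2) by auto
  define s t where "s = (sign_of_bit (fst (\<phi> e)) :: 'a cpoly)" and "t = (sign_of_bit (snd (\<phi> e)) :: 'a cpoly)"
  note st = sign_of_bit_square[of "fst (\<phi> e)", where 'a = "'a cpoly", folded s_def]
    sign_of_bit_square[of "snd (\<phi> e)", where 'a = "'a cpoly", folded t_def]
  note ring = subring_setD[OF subring_set_poly_ring]
  have R: "s \<in> poly_ring E" "t \<in> poly_ring E" "var (X e) \<in> poly_ring E" "var (Y e) \<in> poly_ring E"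
    using e(1) by (auto simp: s_def t_def intro: var_in_poly_ring sign_of_bit_in_subring subring_set_poly_ring)
  have "(var i - flow_point \<phi> i) * edge_delta e (\<phi> e) \<in> I_poly E"
    using e(2)
  proof
    assume i: "i = X e"
    have "(var i - flow_point \<phi> i) * edge_delta e (\<phi> e) =
        ((var (X e) - s) * (1 + s * var (X e))) * (1 + t * var (Y e))"
      by (simp add: i edge_delta_def s_def t_def mult.assoc)
    also have "\<dots> = (s * (1 + t * var (Y e))) * (var (X e) ^ 2 - 1)"
      by (simp only: root[OF st(1)] mult_ac)
    also have "\<dots> \<in> I_poly E"
      by (intro I_poly_mult ring R I_poly_generators e)
    finally show ?thesis .
  next
    assume i: "i = Y e"
    have "(var i - flow_point \<phi> i) * edge_delta e (\<phi> e) =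
        ((var (Y e) - t) * (1 + t * var (Y e))) * (1 + s * var (X e))"
      by (simp add: i edge_delta_def s_def t_def mult_ac)
    also have "\<dots> = (t * (1 + s * var (X e))) * (var (Y e) ^ 2 - 1)"
      by (simp only: root[OF st(2)] mult_ac)
    also have "\<dots> \<in> I_poly E"
      by (intro I_poly_mult ring R I_poly_generators e)
    finally show ?thesis .
  qed
  \<comment> \<open>The factors of the other edges merely multiply an element of the ideal.\<close>
  moreover have "point_delta (E - {e}) \<phi> \<in> poly_ring E"
    unfolding point_delta_def
    by (intro subring_set_prod[OF subring_set_poly_ring] edge_delta_in_poly_ring) auto
  ultimately have "point_delta (E - {e}) \<phi> * ((var i - flow_point \<phi> i) * edge_delta e (\<phi> e)) \<in> I_poly E"
    by (rule I_poly_mult[rotated])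
  then show ?thesis
    unfolding point_delta_def prod.remove[OF assms(1) e(1)] by (simp only: mult_ac)
qed

lemma prod_var_times_point_delta:
  assumes "finite E" "finite S" "S \<subseteq> X ` E \<union> Y ` E"
  shows "((\<Prod>i\<in>S. var i) - (\<Prod>i\<in>S. flow_point \<phi> i)) * point_delta E \<phi> \<in> I_poly E"
  using assms(2,3)
proof (induction S rule: finite_induct)
  case empty
  then show ?case by (simp add: I_poly_0)
next
  case (insert i S)
  let ?p = "\<Prod>i\<in>S. var i" and ?c = "\<Prod>i\<in>S. flow_point \<phi> i"
  have point: "flow_point \<phi> j \<in> poly_ring E" for j
    by (cases j) (auto intro: sign_of_bit_in_subring subring_set_poly_ring)
  \<comment> \<open>Telescoping: x p - a c = x (p - c) + c (x - a), where a is the value of the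
    variable x.\<close>
  have "var i * ((?p - ?c) * point_delta E \<phi>) + ?c * ((var i - flow_point \<phi> i) * point_delta E \<phi>) \<in> I_poly E"
    using insert.prems
    by (intro I_poly_add I_poly_mult insert.IH var_times_point_delta assms(1) var_in_poly_ring
        subring_set_prod[OF subring_set_poly_ring] point) auto
  then show ?case using insert.hyps by (simp add: algebra_simps)
qed

text \<open>Adding 1 is subtracting the value -1 of the product, so this is the previous evaluation
  rule. The constructor \<open>D\<close> treats both coordinates at once.\<close>

lemma vertex_factor_times_point_delta:
  fixes E :: "'e set"
  assumes "finite E" "S \<subseteq> E" "D = X \<or> D = Y"
    and "(\<Prod>e\<in>S. flow_point \<phi> (D e)) = (- 1 :: 'e cpoly)"
  shows "((\<Prod>e\<in>S. var (D e)) + 1) * point_delta E \<phi> \<in> I_poly E"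
proof -
  have inj: "inj_on D S" using assms(3) by (auto simp: inj_on_def)
  have "finite S" using assms(1,2) by (rule finite_subset[rotated])
  then have "((\<Prod>i\<in>D ` S. var i) - (\<Prod>i\<in>D ` S. flow_point \<phi> i)) * point_delta E \<phi> \<in> I_poly E"
    using assms(1-3) by (intro prod_var_times_point_delta) auto
  with assms(4) show ?thesis by (simp add: prod.reindex[OF inj])
qed

text \<open>At some vertex one coordinate sum is 1, so the sign product there is -1. That single
  factor of \<open>f_poly\<close> already sends the delta into the ideal.\<close>

lemma f_poly_times_point_delta:
  fixes E :: "'e set"
  assumes "finite V" "finite E" "\<not> four_flow V E ends \<phi>"
  shows "f_poly V E ends * point_delta E \<phi> \<in> I_poly E"
proof -
  let ?S = "incident_edges E ends"
  have S: "?S v \<subseteq> E" for v by (auto simp: incident_edges_def)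
  obtain v where v: "v \<in> V" and "(\<Sum>e\<in>?S v. fst (\<phi> e)) = 1 \<or> (\<Sum>e\<in>?S v. snd (\<phi> e)) = 1"
    using assms(3) unfolding four_flow_iff by auto
  then have "(\<Prod>e\<in>?S v. flow_point \<phi> (X e)) = (- 1 :: 'e cpoly) \<or>
      (\<Prod>e\<in>?S v. flow_point \<phi> (Y e)) = (- 1 :: 'e cpoly)"
    by (auto simp flip: sign_of_bit_sum)
  then obtain D where D: "D = X \<or> D = Y"
    and prod: "(\<Prod>e\<in>?S v. flow_point \<phi> (D e)) = (- 1 :: 'e cpoly)"
    by blast
  define h where "h D v = (\<Prod>e\<in>?S v. var (D e)) + (1 :: 'e cpoly)" for D v
  have h: "h D v \<in> poly_ring E" if "D = X \<or> D = Y" for D v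
    unfolding h_def using that S
    by (intro subring_setD[OF subring_set_poly_ring] subring_set_prod[OF subring_set_poly_ring]
        var_in_poly_ring) auto
  define r where "r = (\<Prod>w\<in>V - {v}. h X w * h Y w)"
  have r: "r \<in> poly_ring E"
    unfolding r_def
    by (intro subring_setD[OF subring_set_poly_ring] subring_set_prod[OF subring_set_poly_ring] h) auto
  have f: "f_poly V E ends = h X v * h Y v * r"
    unfolding f_poly_def r_def h_def by (rule prod.remove[OF assms(1) v])
  \<comment> \<open>\<open>D'\<close> stands for the other coordinate, which isolates the vanishing
    factor \<open>h D v\<close> in either case.\<close>
  obtain D' where D': "D' = X \<or> D' = Y" "h X v * h Y v = h D' v * h D v"
    using D mult.commute by metis
  have "(r * h D' v) * (h D v * point_delta E \<phi>) \<in> I_poly E"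
    unfolding h_def[of D]
    by (intro I_poly_mult vertex_factor_times_point_delta subring_setD(5)[OF subring_set_poly_ring] r h
        D' D S prod assms(2))
  then show ?thesis by (simp add: f D'(2) mult_ac)
qed

lemma f_poly_in_poly_ring: "f_poly V E ends \<in> poly_ring E"
  unfolding f_poly_def
  by (intro subring_set_prod[OF subring_set_poly_ring] subring_setD[OF subring_set_poly_ring]
      var_in_poly_ring) (auto simp: incident_edges_def)

theorem theorem4p1:
  fixes V :: "'v set" and E :: "'e set" and ends :: "'e \<Rightarrow> 'v set"
  assumes "finite_graph V E ends"
  shows "(\<exists>\<phi>. four_flow V E ends \<phi> \<and> nowhere_zero E \<phi>) \<longleftrightarrow> f_poly V E ends \<notin> I_poly E"
proof
  have fin: "finite V" "finite E" using assms by (auto simp: finite_graph_def)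
  show "f_poly V E ends \<notin> I_poly E" if "\<exists>\<phi>. four_flow V E ends \<phi> \<and> nowhere_zero E \<phi>"
    using that eval_f_poly_flow_point_ne_0[OF fin(1)] eval_I_poly_flow_point by blast
  \<comment> \<open>By contraposition: if every nowhere-zero \<phi> fails to be a flow, the
    interpolation criterion applies to \<open>f_poly\<close> with \<open>F = E\<close>.\<close>
  show "\<exists>\<phi>. four_flow V E ends \<phi> \<and> nowhere_zero E \<phi>" if "f_poly V E ends \<notin> I_poly E"
    using that in_I_poly_if_point_delta[OF fin(2) subset_refl f_poly_in_poly_ring]
      f_poly_times_point_delta[OF fin] by blast
qed

end
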